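(* Let $F\colon\{0,1\}^V\to\mathbb{R}^E$ be a submodular transformation with $F(V)=\mathbf{0}$ and $\mathbf{d}_F(v)>0$ for all $v\in V$. Then the normalized Laplacian $\mathcal{L}_F$ has a non-trivial eigenpair: there exist $\gamma\in\mathbb{R}_{\ge0}$ and a non-zero $\mathbf{z}\in\mathbb{R}^V$ with $\mathbf{z}\perp D_F^{1/2}\mathbf{1}$ and $\gamma\mathbf{z}\in\mathcal{L}_F(\mathbf{z})$. Furthermore, every such $\gamma$ and $\mathbf{z}$ satisfy $\gamma=\mathcal{R}_F(\mathbf{z})$.
   Context: $F_e(S):=F(S)(e)$, each $F_e$ submodular. For $G\colon\{0,1\}^V\to\mathbb{R}$, $B(G)=\{\mathbf{x}:\sum_{v\in S}\mathbf{x}(v)\le G(S)\ \forall S,\ \sum_{v\in V}\mathbf{x}(v)=G(V)\}$, Lovász extension $g(\mathbf{x})=\max_{\mathbf{w}\in B(G)}\langle\mathbf{w},\mathbf{x}\rangle$, $\partial g(\mathbf{x})=\operatorname{argmax}_{\mathbf{w}\in B(G)}\langle\mathbf{w},\mathbf{x}\rangle$; $f_e$ is the Lovász extension of $F_e$. $v$ is relevant to $F_e$ if $F_e(S)\ne F_e(S\cup\{v\})$ for some $S\subseteq V\setminus\{v\}$; $\mathbf{d}_F(v)$ is the number of $e$ to which $v$ is relevant; $D_F=\mathrm{diag}(\mathbf{d}_F)$. $L_F(\mathbf{x})=\{\sum_e\mathbf{w}_e\langle\mathbf{w}_e,\mathbf{x}\rangle:\mathbf{w}_e\in\partial f_e(\mathbf{x})\}$,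 $\mathcal{L}_F(\mathbf{x})=\{D_F^{-1/2}\mathbf{y}:\mathbf{y}\in L_F(D_F^{-1/2}\mathbf{x})\}$, $\mathcal{R}_F(\mathbf{x})=\sum_e f_e(D_F^{-1/2}\mathbf{x})^2/\|\mathbf{x}\|_2^2$.
   Formalization: The formal theorem also assumes the usual normalization F(∅)=0, under which f_e extends F_e; without it the claim fails, e.g. |V|=2, one e, F(∅)=−1 and F=0 elsewhere, where B(F_e) is empty. *)

theory Defs
  imports "HOL-Analysis.Analysis"
begin

text \<open>The cube \<open>{0,1}\<^sup>V\<close> is rendered as the subsets of a finite type \<open>'v\<close>.\<close>

definition submodular :: "('v set \<Rightarrow> real) \<Rightarrow> bool" where
  "submodular G \<longleftrightarrow> (\<forall>S T. G S + G T \<ge> G (S \<inter> T) + G (S \<union> T))"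

definition component :: "('v set \<Rightarrow> real ^ 'e) \<Rightarrow> 'e \<Rightarrow> 'v set \<Rightarrow> real" where
  "component F e S = F S $ e"

definition submodular_transformation :: "('v set \<Rightarrow> real ^ 'e) \<Rightarrow> bool" where
  "submodular_transformation F \<longleftrightarrow> (\<forall>e. submodular (component F e))"

definition base_polytope :: "('v::finite set \<Rightarrow> real) \<Rightarrow> (real ^ 'v) set" where
  "base_polytope G =
     {x. (\<forall>S. (\<Sum>v\<in>S. x $ v) \<le> G S) \<and> (\<Sum>v\<in>UNIV. x $ v) = G UNIV}"

text \<open>
  For submodular \<open>G\<close> with \<open>G {} = 0\<close> the base polytope is compact and non-empty, so this
  supremum is a maximum.
\<close>
definition lovasz_extension :: "('v::finite set \<Rightarrow> real) \<Rightarrow> real ^ 'v \<Rightarrow> real" where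
  "lovasz_extension G x = (SUP w\<in>base_polytope G. w \<bullet> x)"

definition lovasz_subdifferential :: "('v::finite set \<Rightarrow> real) \<Rightarrow> real ^ 'v \<Rightarrow> (real ^ 'v) set" where
  "lovasz_subdifferential G x = {w. is_arg_max (\<lambda>w. w \<bullet> x) (\<lambda>w. w \<in> base_polytope G) w}"

definition relevant :: "'v \<Rightarrow> ('v set \<Rightarrow> real) \<Rightarrow> bool" where
  "relevant v G \<longleftrightarrow> (\<exists>S \<subseteq> UNIV - {v}. G S \<noteq> G (S \<union> {v}))"

definition deg :: "('v set \<Rightarrow> real ^ 'e::finite) \<Rightarrow> 'v \<Rightarrow> nat" where
  "deg F v = card {e. relevant v (component F e)}"

text \<open>The power \<open>D\<^sub>F\<^sup>p\<close> of the diagonal degree matrix (for positive degrees).\<close>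
definition deg_matrix_powr ::
    "('v::finite set \<Rightarrow> real ^ 'e::finite) \<Rightarrow> real \<Rightarrow> real ^ 'v ^ 'v" where
  "deg_matrix_powr F p = (\<chi> u v. if u = v then real (deg F v) powr p else 0)"

definition laplacian ::
    "('v::finite set \<Rightarrow> real ^ 'e::finite) \<Rightarrow> real ^ 'v \<Rightarrow> (real ^ 'v) set" where
  "laplacian F x =
     {(\<Sum>e\<in>UNIV. (w e \<bullet> x) *\<^sub>R w e) | w.
        \<forall>e. w e \<in> lovasz_subdifferential (component F e) x}"

definition normalized_laplacian ::
    "('v::finite set \<Rightarrow> real ^ 'e::finite) \<Rightarrow> real ^ 'v \<Rightarrow> (real ^ 'v) set" where
  "normalized_laplacian F x =
     {deg_matrix_powr F (-1/2) *v y | y. y \<in> laplacian F (deg_matrix_powr F (-1/2) *v x)}"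

definition rayleigh_quotient ::
    "('v::finite set \<Rightarrow> real ^ 'e::finite) \<Rightarrow> real ^ 'v \<Rightarrow> real" where
  "rayleigh_quotient F x =
     (\<Sum>e\<in>UNIV. (lovasz_extension (component F e) (deg_matrix_powr F (-1/2) *v x))\<^sup>2)
       / (norm x)\<^sup>2"

end

theory Submission
  imports Defs
begin

text \<open>
  In the coordinates of \<open>z\<close> every \<open>f\<^sub>e(D\<^sup>-\<^sup>1\<^sup>/\<^sup>2 z)\<close> is the support function of the compact convex set
  \<open>D\<^sup>-\<^sup>1\<^sup>/\<^sup>2 B(F\<^sub>e)\<close>, and \<open>F(V) = 0\<close> makes these sets orthogonal to \<open>D\<^sup>1\<^sup>/\<^sup>2 1\<close>. Let \<open>z\<close> minimise the
  sum of squares of the support functions on the unit sphere of the hyperplane orthogonal to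
  \<open>D\<^sup>1\<^sup>/\<^sup>2 1\<close>, and let \<open>\<gamma>\<close> be the minimum. If \<open>\<gamma> z\<close> were not in the compact convex set
  \<open>\<L>\<^sub>F(z)\<close>, a separating direction, projected to that hyperplane, would be a direction
  of strict descent. The functions \<open>f\<^sub>e\<close> may take negative values, so \<open>f\<^sub>e\<^sup>2\<close> need not be
  convex; only one-sided directional derivatives are used.
\<close>

section \<open>Support functions of compact sets\<close>

text \<open>With \<open>K\<close> a base polytope this is the Lovasz extension. A general
  \<open>K\<close> lets the same facts cover the image of a base polytope under
  \<open>deg_matrix_powr F (-1/2)\<close>.\<close>

definition support_function :: "'a::euclidean_space set \<Rightarrow> 'a \<Rightarrow> real" where
  "support_function K x = (SUP w\<in>K. w \<bullet> x)"

definition support_face :: "'a::euclidean_space set \<Rightarrow> 'a \<Rightarrow> 'a set" where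
  "support_face K x = {w \<in> K. \<forall>y\<in>K. y \<bullet> x \<le> w \<bullet> x}"

lemma support_face_nonempty:
  assumes "compact K" "K \<noteq> {}"
  shows "support_face K x \<noteq> {}"
proof -
  have "continuous_on K (\<lambda>w. w \<bullet> x)" by (intro continuous_intros)
  from continuous_attains_sup[OF assms this] show ?thesis
    by (auto simp: support_face_def)
qed

lemma support_function_eq:
  assumes "w \<in> support_face K x"
  shows "support_function K x = w \<bullet> x"
  unfolding support_function_def
  using assms by (intro cSup_eq_maximum) (auto simp: support_face_def)

lemma inner_le_support_function:
  assumes "compact K" "w \<in> K"
  shows "w \<bullet> x \<le> support_function K x"
proof -
  obtain v where "v \<in> support_face K x"
    using support_face_nonempty[of K x] assms by blast
  then show ?thesis
    using assms support_function_eq[of v K x] by (auto simp: support_face_def)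
qed

lemma support_face_iff:
  assumes "compact K" "K \<noteq> {}"
  shows "w \<in> support_face K x \<longleftrightarrow> w \<in> K \<and> w \<bullet> x = support_function K x"
  using support_function_eq[of w K x] inner_le_support_function[OF assms(1)]
  by (auto simp: support_face_def)

text \<open>Cut out of \<open>K\<close> by a single hyperplane, the face inherits compactness and
  convexity from \<open>K\<close>.\<close>

lemma support_face_eq_Int:
  assumes "compact K" "K \<noteq> {}"
  shows "support_face K x = K \<inter> {w. x \<bullet> w = support_function K x}"
  using support_face_iff[OF assms] by (auto simp: inner_commute)

lemma compact_support_face:
  assumes "compact K" "K \<noteq> {}"
  shows "compact (support_face K x)"
  unfolding support_face_eq_Int[OF assms] using assms(1) closed_hyperplane
  by (rule compact_Int_closed)

lemma convex_support_face:
  assumes "compact K" "K \<noteq> {}" "convex K"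
  shows "convex (support_face K x)"
  unfolding support_face_eq_Int[OF assms(1,2)] using assms(3) convex_hyperplane
  by (rule convex_Int)

lemma support_function_scaleR:
  assumes "compact K" "K \<noteq> {}" "0 \<le> c"
  shows "support_function K (c *\<^sub>R x) = c * support_function K x"
proof -
  obtain w where w: "w \<in> support_face K x"
    using support_face_nonempty[OF assms(1,2)] by blast
  then have "w \<in> support_face K (c *\<^sub>R x)"
    using assms(3) by (auto simp: support_face_def intro: mult_left_mono)
  with w show ?thesis
    by (simp add: support_function_eq)
qed

text \<open>A maximiser \<open>w\<close> at \<open>x\<close> competes at \<open>y\<close>, so the
  value at \<open>x\<close> exceeds that at \<open>y\<close> by at most
  \<open>w \<bullet> (x - y)\<close>. A norm bound on \<open>K\<close> is therefore a Lipschitz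
  constant.\<close>

lemma continuous_on_support_function:
  assumes "compact K" "K \<noteq> {}"
  shows "continuous_on UNIV (support_function K)"
proof -
  obtain C where C: "0 < C" "\<And>w. w \<in> K \<Longrightarrow> norm w \<le> C"
    using compact_imp_bounded[OF assms(1)] unfolding bounded_pos by blast
  have upper: "support_function K x - support_function K y \<le> C * norm (x - y)" for x y
  proof -
    obtain w where w: "w \<in> support_face K x"
      using support_face_nonempty[OF assms] by blast
    then have "w \<in> K" by (simp add: support_face_def)
    have "support_function K x - support_function K y \<le> w \<bullet> (x - y)"
      using support_function_eq[OF w] inner_le_support_function[OF assms(1) \<open>w \<in> K\<close>, of y]
      by (simp add: inner_diff_right)
    also have "\<dots> \<le> norm w * norm (x - y)" by (rule norm_cauchy_schwarz)
    also have "\<dots> \<le> C * norm (x - y)"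
      using C(2)[OF \<open>w \<in> K\<close>] by (intro mult_right_mono) auto
    finally show ?thesis .
  qed
  have "C-lipschitz_on UNIV (support_function K)"
  proof (rule lipschitz_onI)
    show "dist (support_function K x) (support_function K y) \<le> C * dist x y" for x y
      using upper[of x y] upper[of y x]
      by (simp add: dist_norm norm_minus_commute abs_le_iff)
  qed (use C(1) in simp)
  then show ?thesis by (rule lipschitz_on_continuous_on)
qed

text \<open>Closed graph of the face map: each inequality
  \<open>y \<bullet> X n \<le> W n \<bullet> X n\<close> survives the limit.\<close>

lemma support_face_limit:
  assumes K: "compact K" "K \<noteq> {}"
    and W: "\<And>n. W n \<in> support_face K (X n)"
    and lim: "W \<longlonglongrightarrow> w" "X \<longlonglongrightarrow> x"
  shows "w \<in> support_face K x"
proof -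
  have WK: "\<And>n. W n \<in> K" using W by (auto simp: support_face_def)
  have "w \<in> K"
    using closed_sequentially[OF compact_imp_closed[OF K(1)]] WK lim(1) by blast
  moreover have "y \<bullet> x \<le> w \<bullet> x" if "y \<in> K" for y
  proof (rule LIMSEQ_le)
    show "(\<lambda>n. y \<bullet> X n) \<longlonglongrightarrow> y \<bullet> x" "(\<lambda>n. W n \<bullet> X n) \<longlonglongrightarrow> w \<bullet> x"
      by (intro tendsto_intros lim)+
    show "\<exists>N. \<forall>n\<ge>N. y \<bullet> X n \<le> W n \<bullet> X n"
      using W that by (auto simp: support_face_def)
  qed
  ultimately show ?thesis by (simp add: support_face_def)
qed

lemma compact_linear_image:
  fixes T :: "'a::euclidean_space \<Rightarrow> 'b::euclidean_space"
  assumes "linear T" "compact K"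
  shows "compact (T ` K)"
  using assms by (intro compact_continuous_image linear_continuous_on) (simp_all add: linear_conv_bounded_linear)

section \<open>Products of finitely many sets\<close>

text \<open>Families are encoded as elements of \<open>'a ^ 'e\<close>, so that the product lies in
  a Euclidean space: one subsequence converges in all coordinates at once, and a linear map can act
  on the whole family.\<close>

lemma compact_vec_product:
  fixes K :: "'e::finite \<Rightarrow> 'a::euclidean_space set"
  assumes "\<And>e. compact (K e)"
  shows "compact {W :: 'a ^ 'e. \<forall>e. W $ e \<in> K e}"
  unfolding compact_eq_bounded_closed
proof
  have "\<forall>e. \<exists>C. \<forall>w\<in>K e. norm w \<le> C"
    using compact_imp_bounded[OF assms] by (auto simp: bounded_iff)
  then obtain C where C: "\<And>e w. w \<in> K e \<Longrightarrow> norm w \<le> C e" by metis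
  show "bounded {W :: 'a ^ 'e. \<forall>e. W $ e \<in> K e}"
  proof (rule boundedI)
    fix W :: "'a ^ 'e" assume "W \<in> {W. \<forall>e. W $ e \<in> K e}"
    then have "\<And>e. norm (W $ e) \<le> C e" using C by blast
    then show "norm W \<le> (\<Sum>e\<in>UNIV. C e)"
      unfolding norm_vec_def by (intro order_trans[OF L2_set_le_sum] sum_mono) auto
  qed
  have "closed (\<Inter>e. (\<lambda>W :: 'a ^ 'e. W $ e) -` K e)"
    using compact_imp_closed[OF assms]
    by (intro closed_INT ballI closed_vimage continuous_intros) auto
  moreover have "(\<Inter>e. (\<lambda>W :: 'a ^ 'e. W $ e) -` K e) = {W. \<forall>e. W $ e \<in> K e}" by auto
  ultimately show "closed {W :: 'a ^ 'e. \<forall>e. W $ e \<in> K e}" by simp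
qed

lemma convex_vec_product:
  fixes K :: "'e::finite \<Rightarrow> 'a::real_vector set"
  assumes "\<And>e. convex (K e)"
  shows "convex {W :: 'a ^ 'e. \<forall>e. W $ e \<in> K e}"
  using assms by (auto simp: convex_def)

section \<open>Eigenvectors from support functions\<close>

text \<open>Taking maximisers at nearby points in the product of all the \<open>K e\<close> yields one sequence that serves every \<open>e\<close>.\<close>
lemma support_function_one_sided_derivative:
  fixes K :: "'e::finite \<Rightarrow> 'a::euclidean_space set"
  assumes K: "\<And>e. compact (K e)" "\<And>e. K e \<noteq> {}"
  obtains w t where "\<And>e. w e \<in> support_face (K e) z" "\<And>n::nat. 0 < t n" "t \<longlonglongrightarrow> 0"
    "\<And>e. (\<lambda>n. (support_function (K e) (z + t n *\<^sub>R d) - support_function (K e) z) / t n) \<longlonglongrightarrow> w e \<bullet> d"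
proof -
  define s :: "nat \<Rightarrow> real" where "s n = inverse (real (Suc n))" for n
  have s: "s \<longlonglongrightarrow> 0" "\<And>n. 0 < s n"
    unfolding s_def by (rule LIMSEQ_inverse_real_of_nat) simp
  define V where "V n e = (SOME w. w \<in> support_face (K e) (z + s n *\<^sub>R d))" for n e
  have V: "V n e \<in> support_face (K e) (z + s n *\<^sub>R d)" for n e
    unfolding V_def using support_face_nonempty[OF K] by (simp add: some_in_eq)
  define W :: "nat \<Rightarrow> 'a ^ 'e" where "W n = (\<chi> e. V n e)" for n
  have "\<forall>n. W n \<in> {W. \<forall>e. W $ e \<in> K e}"
    using V by (auto simp: W_def support_face_def)
  then obtain w r where r: "strict_mono r" and lim: "(W \<circ> r) \<longlonglongrightarrow> w"
    using compact_vec_product[of K, OF K(1)] unfolding compact_def by blast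
  define t where "t = s \<circ> r"
  have t: "t \<longlonglongrightarrow> 0" "\<And>n. 0 < t n"
    using LIMSEQ_subseq_LIMSEQ[OF s(1) r] s(2) by (auto simp: t_def)
  have Ve: "(\<lambda>n. V (r n) e) \<longlonglongrightarrow> w $ e" for e
    using tendsto_vec_nth[OF lim, of e] by (simp add: W_def o_def)
  have "(\<lambda>n. z + t n *\<^sub>R d) \<longlonglongrightarrow> z + 0 *\<^sub>R d"
    by (intro tendsto_intros t(1))
  then have zt: "(\<lambda>n. z + t n *\<^sub>R d) \<longlonglongrightarrow> z" by simp
  have face: "w $ e \<in> support_face (K e) z" for e
    using support_face_limit[OF K _ Ve zt] V by (simp add: t_def)
  have "(\<lambda>n. (support_function (K e) (z + t n *\<^sub>R d) - support_function (K e) z) / t n) \<longlonglongrightarrow> w $ e \<bullet> d"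
    for e
  \<comment> \<open>The limit \<open>w $ e\<close> competes at \<open>z + t n *\<^sub>R d\<close>,
    which bounds the quotient from below; \<open>V (r n) e\<close> competes at \<open>z\<close>,
    which bounds it from above.\<close>
  proof (rule real_tendsto_sandwich)
    show "(\<lambda>n. w $ e \<bullet> d) \<longlonglongrightarrow> w $ e \<bullet> d" "(\<lambda>n. V (r n) e \<bullet> d) \<longlonglongrightarrow> w $ e \<bullet> d"
      by (intro tendsto_intros Ve)+
    have "w $ e \<bullet> d \<le> (support_function (K e) (z + t n *\<^sub>R d) - support_function (K e) z) / t n" for n
    proof -
      have "w $ e \<bullet> (z + t n *\<^sub>R d) \<le> support_function (K e) (z + t n *\<^sub>R d)"
        using face[of e] by (intro inner_le_support_function K) (auto simp: support_face_def)
      then show ?thesis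
        using t(2)[of n] support_function_eq[OF face[of e]]
        by (simp add: field_simps inner_add_right)
    qed
    then show "\<forall>\<^sub>F n in sequentially. w $ e \<bullet> d
        \<le> (support_function (K e) (z + t n *\<^sub>R d) - support_function (K e) z) / t n" by simp
    have "(support_function (K e) (z + t n *\<^sub>R d) - support_function (K e) z) / t n \<le> V (r n) e \<bullet> d" for n
    proof -
      have Vf: "V (r n) e \<in> support_face (K e) (z + t n *\<^sub>R d)" using V by (simp add: t_def)
      then have "V (r n) e \<bullet> z \<le> support_function (K e) z"
        by (intro inner_le_support_function K) (auto simp: support_face_def)
      then show ?thesis
        using t(2)[of n] support_function_eq[OF Vf]
        by (simp add: field_simps inner_add_right)
    qed
    then show "\<forall>\<^sub>F n in sequentially.
        (support_function (K e) (z + t n *\<^sub>R d) - support_function (K e) z) / t n \<le> V (r n) e \<bullet> d" by simp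
  qed
  with face t that show thesis by blast
qed

text \<open>Absorbing the degree matrix into the sets \<open>K e\<close> leaves a problem about the
  standard inner product. The bound \<open>dim\<close> ensures that the hyperplane orthogonal to
  \<open>u\<close> contains a unit vector.\<close>

theorem support_functions_eigenvector:
  fixes K :: "'e::finite \<Rightarrow> 'a::euclidean_space set"
  assumes K: "\<And>e. compact (K e)" "\<And>e. K e \<noteq> {}" "\<And>e. convex (K e)"
    and perp: "\<And>e w. w \<in> K e \<Longrightarrow> w \<bullet> u = 0"
    and dim: "2 \<le> DIM('a)"
  obtains \<gamma> z w where "0 \<le> \<gamma>" "z \<noteq> 0" "z \<bullet> u = 0" "\<And>e. w e \<in> support_face (K e) z"
    "\<gamma> *\<^sub>R z = (\<Sum>e\<in>UNIV. (w e \<bullet> z) *\<^sub>R w e)"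
proof -
  define h where "h e = support_function (K e)" for e
  define \<Phi> where "\<Phi> x = (\<Sum>e\<in>UNIV. (h e x)\<^sup>2)" for x
  define S where "S = sphere 0 1 \<inter> {x :: 'a. u \<bullet> x = 0}"
  have "compact S" unfolding S_def by (intro compact_Int_closed closed_hyperplane) simp
  moreover have "S \<noteq> {}"
  proof -
    obtain y where "y \<noteq> 0" "u \<bullet> y = 0"
      using orthogonal_to_vector_exists[OF dim, of u] by (auto simp: orthogonal_def)
    then have "y /\<^sub>R norm y \<in> S" by (simp add: S_def)
    then show ?thesis by blast
  qed
  moreover have "continuous_on UNIV \<Phi>"
    unfolding \<Phi>_def h_def by (intro continuous_intros continuous_on_support_function K)
  then have "continuous_on S \<Phi>" by (rule continuous_on_subset) simp
  ultimately obtain z where z: "z \<in> S" and min: "\<And>y. y \<in> S \<Longrightarrow> \<Phi> z \<le> \<Phi> y"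
    using continuous_attains_inf[of S \<Phi>] by blast
  have nz: "z \<noteq> 0" "z \<bullet> z = 1" and uz: "z \<bullet> u = 0"
    using z by (auto simp: S_def inner_commute norm_eq_1)
  define \<gamma> where "\<gamma> = \<Phi> z"
  have "0 \<le> \<gamma>" unfolding \<gamma>_def \<Phi>_def by (intro sum_nonneg) simp
  \<comment> \<open>Positive homogeneity of each \<open>h e\<close> makes \<Phi> homogeneous of
    degree 2, so the minimum over \<open>S\<close> becomes a quadratic lower bound on the whole
    hyperplane.\<close>
  have \<Phi>_ge: "\<gamma> * (y \<bullet> y) \<le> \<Phi> y" if "y \<bullet> u = 0" for y
  proof (cases "y = 0")
    case True
    have "0 \<le> \<Phi> y" unfolding \<Phi>_def by (intro sum_nonneg) simp
    with True show ?thesis by simp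
  next
    case False
    have "y /\<^sub>R norm y \<in> S" using that False by (simp add: S_def inner_commute)
    from min[OF this] have "\<gamma> \<le> \<Phi> (y /\<^sub>R norm y)" by (simp add: \<gamma>_def)
    also have "\<Phi> (y /\<^sub>R norm y) = \<Phi> y / (norm y)\<^sup>2"
      unfolding \<Phi>_def h_def
      by (simp add: support_function_scaleR K sum_divide_distrib power_mult_distrib field_simps)
    finally show ?thesis
      using False by (simp add: field_simps power2_norm_eq_inner)
  qed
  \<comment> \<open>On the face at \<open>z\<close> every \<open>w\<close> satisfies
    \<open>w \<bullet> z = h e z\<close>. The coefficients of the Laplacian sum are thus constant
    there and the sum is the linear map \<open>T\<close>, so its values over \<open>P\<close> form a
    compact convex set.\<close>
  define P where "P = {W :: 'a ^ 'e. \<forall>e. W $ e \<in> support_face (K e) z}"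
  define T where "T W = (\<Sum>e\<in>UNIV. h e z *\<^sub>R (W $ e))" for W :: "'a ^ 'e"
  have "linear T"
    unfolding T_def
    by (intro linearI) (simp_all add: scaleR_add_right sum.distrib scaleR_sum_right mult.commute)
  have "compact (T ` P)" "convex (T ` P)"
    unfolding P_def
    by (intro compact_linear_image convex_linear_image compact_vec_product compact_support_face
        convex_vec_product convex_support_face K \<open>linear T\<close>)+
  have "\<gamma> *\<^sub>R z \<in> T ` P"
  proof (rule ccontr)
    assume "\<gamma> *\<^sub>R z \<notin> T ` P"
    then obtain a b where a: "a \<bullet> (\<gamma> *\<^sub>R z) < b" "\<And>x. x \<in> T ` P \<Longrightarrow> b < a \<bullet> x"
      using separating_hyperplane_closed_point[of "T ` P" "\<gamma> *\<^sub>R z"]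
        \<open>compact (T ` P)\<close> \<open>convex (T ` P)\<close> compact_imp_closed by blast
    \<comment> \<open>The negated projection of \<open>a\<close> to the hyperplane orthogonal to
      \<open>u\<close>. If \<open>u = 0\<close>, the quotient is 0 by the convention for division
      and \<open>d = - a\<close>.\<close>
    define d where "d = ((a \<bullet> u) / (u \<bullet> u)) *\<^sub>R u - a"
    have du: "d \<bullet> u = 0" by (simp add: d_def inner_diff_left)
    obtain w t where w: "\<And>e. w e \<in> support_face (K e) z" and t: "\<And>n::nat. 0 < t n" "t \<longlonglongrightarrow> 0"
      and lim: "\<And>e. (\<lambda>n. (h e (z + t n *\<^sub>R d) - h e z) / t n) \<longlonglongrightarrow> w e \<bullet> d"
      unfolding h_def using support_function_one_sided_derivative[of K, OF K(1,2)] by blast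
    define k where "k = (\<Sum>e\<in>UNIV. h e z *\<^sub>R w e)"
    have "k = T (\<chi> e. w e)" by (simp add: k_def T_def)
    with w have "k \<in> T ` P" by (auto simp: P_def)
    have "w e \<bullet> u = 0" for e using perp w by (auto simp: support_face_def)
    then have "k \<bullet> u = 0" by (simp add: k_def inner_sum_left)
    then have kd: "k \<bullet> d = - (a \<bullet> k)" by (simp add: d_def inner_diff_right inner_commute)
    have zd: "z \<bullet> d = - (a \<bullet> z)" using uz by (simp add: d_def inner_diff_right inner_commute)
    \<comment> \<open>Both \<open>k\<close> and \<open>z\<close> are orthogonal to \<open>u\<close>,
      so pairing them with \<open>d\<close> is minus pairing them with \<open>a\<close>, which
      reverses the separation
      \<open>a \<bullet> (\<gamma> *\<^sub>R z) < b < a \<bullet> k\<close>.\<close>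
    have descent: "k \<bullet> d < \<gamma> * (z \<bullet> d)"
      using a(1) a(2)[OF \<open>k \<in> T ` P\<close>] kd zd by simp
    have "(\<lambda>n. z + t n *\<^sub>R d) \<longlonglongrightarrow> z + 0 *\<^sub>R d"
      by (intro tendsto_intros t(2))
    then have zt: "(\<lambda>n. z + t n *\<^sub>R d) \<longlonglongrightarrow> z" by simp
    have h_lim: "(\<lambda>n. h e (z + t n *\<^sub>R d)) \<longlonglongrightarrow> h e z" for e
      using continuous_on_tendsto_compose[OF continuous_on_support_function[OF K(1,2)] zt, of e]
      by (simp add: h_def)
    \<comment> \<open>Each difference of squares factors into a sum, which converges by continuity,
      and a difference quotient, which converges by \<open>lim\<close>.\<close>
    have "(\<lambda>n. \<Sum>e\<in>UNIV. (h e (z + t n *\<^sub>R d) + h e z) * ((h e (z + t n *\<^sub>R d) - h e z) / t n))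
      \<longlonglongrightarrow> (\<Sum>e\<in>UNIV. (h e z + h e z) * (w e \<bullet> d))"
      by (intro tendsto_intros h_lim lim)
    also have "(\<Sum>e\<in>UNIV. (h e z + h e z) * (w e \<bullet> d)) = 2 * (k \<bullet> d)"
      by (simp add: k_def inner_sum_left sum_distrib_left algebra_simps)
    also have "(\<lambda>n. \<Sum>e\<in>UNIV. (h e (z + t n *\<^sub>R d) + h e z) * ((h e (z + t n *\<^sub>R d) - h e z) / t n))
      = (\<lambda>n. (\<Phi> (z + t n *\<^sub>R d) - \<Phi> z) / t n)"
      unfolding \<Phi>_def
      by (simp add: sum_subtractf[symmetric] sum_divide_distrib power2_eq_square algebra_simps)
    finally have \<Phi>_lim: "(\<lambda>n. (\<Phi> (z + t n *\<^sub>R d) - \<Phi> z) / t n) \<longlonglongrightarrow> 2 * (k \<bullet> d)" .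
    have "(\<lambda>n. \<gamma> * (2 * (z \<bullet> d) + t n * (d \<bullet> d))) \<longlonglongrightarrow> \<gamma> * (2 * (z \<bullet> d) + 0 * (d \<bullet> d))"
      by (intro tendsto_intros t(2))
    \<comment> \<open>The point \<open>z + t n *\<^sub>R d\<close> stays in the hyperplane, so
      \<open>\<Phi>_ge\<close> applies to it. Subtracting \<open>\<gamma> = \<Phi> z\<close> and
      dividing by \<open>t n\<close> bounds the difference quotient from below; the limit
      contradicts \<open>descent\<close>.\<close>
    moreover have "\<gamma> * (2 * (z \<bullet> d) + t n * (d \<bullet> d)) \<le> (\<Phi> (z + t n *\<^sub>R d) - \<Phi> z) / t n" for n
    proof -
      have "\<gamma> * ((z + t n *\<^sub>R d) \<bullet> (z + t n *\<^sub>R d)) \<le> \<Phi> (z + t n *\<^sub>R d)"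
        using uz du by (intro \<Phi>_ge) (simp add: inner_add_left)
      moreover have "(z + t n *\<^sub>R d) \<bullet> (z + t n *\<^sub>R d) = 1 + t n * (2 * (z \<bullet> d) + t n * (d \<bullet> d))"
        using nz(2) by (simp add: inner_add_left inner_add_right inner_commute algebra_simps)
      ultimately have "\<gamma> * (1 + t n * (2 * (z \<bullet> d) + t n * (d \<bullet> d))) \<le> \<Phi> (z + t n *\<^sub>R d)" by simp
      then have "\<gamma> * (2 * (z \<bullet> d) + t n * (d \<bullet> d)) * t n \<le> \<Phi> (z + t n *\<^sub>R d) - \<Phi> z"
        by (simp add: \<gamma>_def algebra_simps)
      then show ?thesis using t(1)[of n] by (simp add: pos_le_divide_eq)
    qed
    ultimately have "\<gamma> * (2 * (z \<bullet> d) + 0 * (d \<bullet> d)) \<le> 2 * (k \<bullet> d)"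
      using LIMSEQ_le[OF _ \<Phi>_lim] by blast
    with descent show False by simp
  qed
  then obtain W where W: "\<And>e. W $ e \<in> support_face (K e) z" "\<gamma> *\<^sub>R z = T W"
    by (auto simp: P_def)
  then have "\<gamma> *\<^sub>R z = (\<Sum>e\<in>UNIV. (W $ e \<bullet> z) *\<^sub>R W $ e)"
    by (simp add: T_def h_def support_function_eq[OF W(1)])
  with that \<open>0 \<le> \<gamma>\<close> nz(1) uz W(1) show thesis by blast
qed

section \<open>The base polytope\<close>

text \<open>Edmonds' greedy algorithm.\<close>
lemma submodular_greedy:
  assumes "submodular G" "G {} = 0" "finite A"
  shows "\<exists>x :: 'v \<Rightarrow> real. (\<forall>S\<subseteq>A. sum x S \<le> G S) \<and> sum x A = G A"
  using assms(3)
proof (induction A rule: finite_induct)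
  case empty
  with assms(2) show ?case by simp
next
  case (insert v A)
  then obtain x where x: "\<And>S. S \<subseteq> A \<Longrightarrow> sum x S \<le> G S" "sum x A = G A" by blast
  \<comment> \<open>The new element receives its marginal value over \<open>A\<close>, which makes
    the constraint of \<open>insert v A\<close> tight and leaves the coordinates on \<open>A\<close>
    unchanged.\<close>
  define y where "y = x(v := G (insert v A) - G A)"
  have y: "sum y S = sum x S" if "S \<subseteq> A" for S
    using that insert.hyps by (intro sum.cong) (auto simp: y_def)
  have "sum y (insert v A) = G (insert v A)"
    using insert.hyps y[of A] x(2) by (simp add: y_def)
  moreover have "sum y S \<le> G S" if S: "S \<subseteq> insert v A" for S
  proof (cases "v \<in> S")
    case False
    with S have "S \<subseteq> A" by auto
    then show ?thesis using x(1) y by simp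
  next
    case True
    have "finite S" using S insert.hyps finite_subset by blast
    have "S - {v} \<subseteq> A" using S by auto
    \<comment> \<open>Diminishing returns: submodularity for \<open>S\<close> and \<open>A\<close>
      says that \<open>v\<close> gains no more over \<open>A\<close> than over
      \<open>S - {v}\<close>, that is, \<open>y v \<le> G S - G (S - {v})\<close>.\<close>
    have "S \<inter> A = S - {v}" "S \<union> A = insert v A" using S True insert.hyps by auto
    moreover have "G (S \<inter> A) + G (S \<union> A) \<le> G S + G A"
      using assms(1) by (auto simp: submodular_def)
    moreover have "sum y S = y v + sum y (S - {v})"
      using True \<open>finite S\<close> by (rule sum.remove[rotated])
    moreover have "sum y (S - {v}) \<le> G (S - {v})"
      using x(1) y \<open>S - {v} \<subseteq> A\<close> by simp
    ultimately show ?thesis by (simp add: y_def)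
  qed
  ultimately show ?case by blast
qed

lemma base_polytope_nonempty:
  fixes G :: "'v::finite set \<Rightarrow> real"
  assumes "submodular G" "G {} = 0"
  shows "base_polytope G \<noteq> {}"
proof -
  obtain x where "\<And>S. sum x S \<le> G S" "sum x UNIV = G UNIV"
    using submodular_greedy[OF assms finite_class.finite_UNIV] by auto
  then have "(\<chi> v. x v) \<in> base_polytope G" by (simp add: base_polytope_def)
  then show ?thesis by blast
qed

lemma convex_base_polytope:
  fixes G :: "'v::finite set \<Rightarrow> real"
  shows "convex (base_polytope G)"
proof (rule convexI)
  fix x y :: "real ^ 'v" and a b :: real
  assume xy: "x \<in> base_polytope G" "y \<in> base_polytope G" and ab: "0 \<le> a" "0 \<le> b" "a + b = 1"
  have eq: "(\<Sum>v\<in>S. (a *\<^sub>R x + b *\<^sub>R y) $ v) = a * (\<Sum>v\<in>S. x $ v) + b * (\<Sum>v\<in>S. y $ v)" for S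
    by (simp add: sum.distrib sum_distrib_left)
  have G: "a * G S + b * G S = G S" for S
    using ab(3) by (simp add: distrib_right[symmetric])
  have "a * (\<Sum>v\<in>S. x $ v) + b * (\<Sum>v\<in>S. y $ v) \<le> a * G S + b * G S" for S
    using xy ab by (intro add_mono mult_left_mono) (auto simp: base_polytope_def)
  then show "a *\<^sub>R x + b *\<^sub>R y \<in> base_polytope G"
    using xy G unfolding base_polytope_def mem_Collect_eq eq by auto
qed

lemma compact_base_polytope: "compact (base_polytope G)"
  unfolding compact_eq_bounded_closed
proof
  show "bounded (base_polytope G)"
  proof (rule boundedI)
    fix x assume x: "x \<in> base_polytope G"
    \<comment> \<open>The constraint of \<open>{v}\<close> bounds the coordinate from above; the
      fixed total minus the constraint of \<open>UNIV - {v}\<close> bounds it from below.\<close>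
    have "\<bar>x $ v\<bar> \<le> \<bar>G {v}\<bar> + \<bar>G UNIV\<bar> + \<bar>G (UNIV - {v})\<bar>" for v
    proof -
      have sums: "\<And>S. (\<Sum>v\<in>S. x $ v) \<le> G S" "(\<Sum>v\<in>UNIV. x $ v) = G UNIV"
        using x by (auto simp: base_polytope_def)
      have "(\<Sum>v\<in>UNIV. x $ v) = x $ v + (\<Sum>v\<in>UNIV - {v}. x $ v)"
        by (rule sum.remove) auto
      with sums(1)[of "{v}"] sums(1)[of "UNIV - {v}"] sums(2) show ?thesis by simp
    qed
    then show "norm x \<le> (\<Sum>v\<in>UNIV. \<bar>G {v}\<bar> + \<bar>G UNIV\<bar> + \<bar>G (UNIV - {v})\<bar>)"
      by (intro order_trans[OF norm_le_l1_cart] sum_mono) auto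
  qed
  show "closed (base_polytope G)"
    unfolding base_polytope_def
    by (intro closed_Collect_conj closed_Collect_all closed_Collect_le closed_Collect_eq continuous_intros)
qed

lemma lovasz_subdifferential_eq: "lovasz_subdifferential G x = support_face (base_polytope G) x"
  by (auto simp: lovasz_subdifferential_def support_face_def is_arg_max_def not_less)

lemma lovasz_extension_eq: "lovasz_extension G x = support_function (base_polytope G) x"
  by (simp add: lovasz_extension_def support_function_def)

section \<open>The normalized Laplacian\<close>

lemma deg_matrix_powr_mult_nth: "(deg_matrix_powr F p *v x) $ v = real (deg F v) powr p * x $ v"
  by (simp add: deg_matrix_powr_def matrix_vector_mult_def if_distrib[of "\<lambda>a. a * _"] cong: if_cong)

lemma deg_matrix_powr_self_adjoint:
  "(deg_matrix_powr F p *v x) \<bullet> y = x \<bullet> (deg_matrix_powr F p *v y)"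
  by (simp add: inner_vec_def deg_matrix_powr_mult_nth mult_ac)

lemma deg_matrix_powr_inverse_sqrt:
  assumes "\<And>v. deg F v > 0"
  shows "deg_matrix_powr F (-1/2) *v (deg_matrix_powr F (1/2) *v x) = x"
proof -
  have "real (deg F v) powr (-1/2) * (real (deg F v) powr (1/2) * x $ v) = x $ v" for v
    using assms[of v] by (simp add: mult.assoc[symmetric] powr_add[symmetric])
  then show ?thesis
    by (simp add: vec_eq_iff deg_matrix_powr_mult_nth)
qed

text \<open>With a single vertex, relevance can only be witnessed by the empty set, where it would
  need \<open>F {}\<close> and \<open>F UNIV\<close> to differ. This supplies the dimension bound of
  \<open>support_functions_eigenvector\<close>.\<close>

lemma card_ge_2_if_degrees_positive:
  fixes F :: "'v::finite set \<Rightarrow> real ^ 'e::finite"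
  assumes "F {} = F UNIV" "\<And>v. deg F v > 0"
  shows "2 \<le> CARD('v)"
proof (rule ccontr)
  assume "\<not> 2 \<le> CARD('v)"
  then have "CARD('v) = 1" using zero_less_card_finite[where 'a='v] by linarith
  then obtain v :: 'v where v: "UNIV = {v}" by (auto simp: card_1_singleton_iff)
  have "\<not> relevant v (component F e)" for e
    using assms(1) v by (auto simp: relevant_def component_def)
  then have "deg F v = 0" by (simp add: deg_def)
  with assms(2)[of v] show False by simp
qed

text \<open>Pair the eigenvalue equation with \<open>z\<close>. Self-adjointness moves the matrix
  onto \<open>z\<close>, and each \<open>w e \<bullet> x\<close> is the value of the Lovasz
  extension at \<open>x\<close>, so the numerator of the Rayleigh quotient appears.\<close>

lemma eigenvalue_eq_rayleigh_quotient:
  assumes "z \<noteq> 0" "\<gamma> *\<^sub>R z \<in> normalized_laplacian F z"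
  shows "\<gamma> = rayleigh_quotient F z"
proof -
  define x where "x = deg_matrix_powr F (-1/2) *v z"
  obtain w where w: "\<And>e. w e \<in> lovasz_subdifferential (component F e) x"
    and eq: "\<gamma> *\<^sub>R z = deg_matrix_powr F (-1/2) *v (\<Sum>e\<in>UNIV. (w e \<bullet> x) *\<^sub>R w e)"
    using assms(2) unfolding normalized_laplacian_def laplacian_def x_def by blast
  have "\<gamma> * (norm z)\<^sup>2 = (\<gamma> *\<^sub>R z) \<bullet> z" by (simp add: power2_norm_eq_inner)
  also have "\<dots> = (\<Sum>e\<in>UNIV. (w e \<bullet> x)\<^sup>2)"
    unfolding eq deg_matrix_powr_self_adjoint x_def[symmetric]
    by (simp add: inner_sum_left power2_eq_square)
  also have "\<dots> = (\<Sum>e\<in>UNIV. (lovasz_extension (component F e) x)\<^sup>2)"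
    using support_function_eq[OF w[unfolded lovasz_subdifferential_eq]] by (simp add: lovasz_extension_eq)
  finally show ?thesis
    using assms(1) by (simp add: rayleigh_quotient_def x_def field_simps)
qed

lemma normalized_laplacian_eigenpair_exists:
  fixes F :: "'v::finite set \<Rightarrow> real ^ 'e::finite"
  assumes "submodular_transformation F" "F {} = 0" "F UNIV = 0" "\<And>v. deg F v > 0"
  obtains \<gamma> z where "0 \<le> \<gamma>" "z \<noteq> 0" "orthogonal z (deg_matrix_powr F (1/2) *v vec 1)"
    "\<gamma> *\<^sub>R z \<in> normalized_laplacian F z"
proof -
  define A where "A = deg_matrix_powr F (-1/2)"
  define u where "u = deg_matrix_powr F (1/2) *v vec 1"
  define B where "B e = base_polytope (component F e)" for e
  have "submodular (component F e)" "component F e {} = 0" for e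
    using assms(1,2) by (auto simp: submodular_transformation_def component_def)
  then have B: "B e \<noteq> {}" "compact (B e)" "convex (B e)" for e
    unfolding B_def by (simp_all add: base_polytope_nonempty compact_base_polytope convex_base_polytope)
  have "linear ((*v) A)" by (rule matrix_vector_mul_linear)
  \<comment> \<open>The two half powers cancel, leaving the coordinate sum of a point of the base
    polytope, which is \<open>F UNIV $ e = 0\<close>.\<close>
  have perp: "w \<bullet> u = 0" if "w \<in> (*v) A ` B e" for e w
  proof -
    from that obtain w' where w': "w' \<in> B e" "w = A *v w'" by blast
    then have "w \<bullet> u = w' \<bullet> vec 1"
      using deg_matrix_powr_inverse_sqrt[OF assms(4)] by (simp add: A_def u_def deg_matrix_powr_self_adjoint)
    also have "\<dots> = (\<Sum>v\<in>UNIV. w' $ v)" by (simp add: inner_vec_def)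
    also have "\<dots> = 0"
      using w'(1) assms(3) by (simp add: B_def base_polytope_def component_def)
    finally show ?thesis .
  qed
  have "2 \<le> DIM(real ^ 'v)"
    using card_ge_2_if_degrees_positive[OF _ assms(4)] assms(2,3) by simp
  then obtain \<gamma> z w where \<gamma>: "0 \<le> \<gamma>" and z: "z \<noteq> 0" "z \<bullet> u = 0"
    and w: "\<And>e. w e \<in> support_face ((*v) A ` B e) z"
    and eq: "\<gamma> *\<^sub>R z = (\<Sum>e\<in>UNIV. (w e \<bullet> z) *\<^sub>R w e)"
    using support_functions_eigenvector[of "\<lambda>e. (*v) A ` B e" u] perp B
      compact_linear_image[OF \<open>linear ((*v) A)\<close>] convex_linear_image[OF \<open>linear ((*v) A)\<close>]
    by (smt (verit) image_is_empty)
  have adj: "(A *v x) \<bullet> y = x \<bullet> (A *v y)" for x y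
    by (simp add: A_def deg_matrix_powr_self_adjoint)
  \<comment> \<open>As \<open>A\<close> is self-adjoint, \<open>A *v y\<close> is maximal over the
    image in direction \<open>z\<close> exactly when \<open>y\<close> is maximal over
    \<open>B e\<close> in direction \<open>A *v z\<close>.\<close>
  have "\<exists>y. w e = A *v y \<and> y \<in> support_face (B e) (A *v z)" for e
    using w[of e] by (auto simp: support_face_def adj)
  then obtain y where y: "\<And>e. w e = A *v y e" "\<And>e. y e \<in> support_face (B e) (A *v z)" by metis
  have "\<gamma> *\<^sub>R z = A *v (\<Sum>e\<in>UNIV. (y e \<bullet> (A *v z)) *\<^sub>R y e)"
    unfolding eq linear_sum[OF \<open>linear ((*v) A)\<close>]
    by (simp add: y(1) adj linear_cmul[OF \<open>linear ((*v) A)\<close>])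
  moreover have "(\<Sum>e\<in>UNIV. (y e \<bullet> (A *v z)) *\<^sub>R y e) \<in> laplacian F (A *v z)"
    unfolding laplacian_def using y(2) by (auto simp: lovasz_subdifferential_eq B_def)
  ultimately have "\<gamma> *\<^sub>R z \<in> normalized_laplacian F z"
    unfolding normalized_laplacian_def A_def by blast
  with that \<gamma> z show thesis by (simp add: orthogonal_def u_def)
qed

theorem theorem3p4:
  fixes F :: "'v::finite set \<Rightarrow> real ^ 'e::finite"
  assumes "submodular_transformation F"
    and "F {} = 0"
    and "F UNIV = 0"
    and "\<And>v. deg F v > 0"
  shows "(\<exists>\<gamma> z. \<gamma> \<ge> 0 \<and> z \<noteq> 0 \<and> orthogonal z (deg_matrix_powr F (1/2) *v vec 1)
                 \<and> \<gamma> *\<^sub>R z \<in> normalized_laplacian F z)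
       \<and> (\<forall>\<gamma> z. \<gamma> \<ge> 0 \<and> z \<noteq> 0 \<and> orthogonal z (deg_matrix_powr F (1/2) *v vec 1)
                 \<and> \<gamma> *\<^sub>R z \<in> normalized_laplacian F z
                 \<longrightarrow> \<gamma> = rayleigh_quotient F z)"
  using normalized_laplacian_eigenpair_exists[OF assms] eigenvalue_eq_rayleigh_quotient[of _ _ F]
  by metis

end
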